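(* Let $X$ be a real Hilbert space, let $T\colon X\to X$ be firmly nonexpansive, let $A\colon X\rightrightarrows X$ be maximally monotone, and suppose that $T=J_A$, or equivalently that $A=T^{-1}-\mathrm{Id}$. For a mapping $S\colon X\to X$ consider the property $$(R)\quad(\forall x\in X)(\forall y\in X)\quad\inf_{z\in X}\langle Sx-Sz,(y-Sy)-(z-Sz)\rangle>-\infty.$$ Then the following are equivalent: (i) $S=T$ satisfies (R). (ii) $A$ is rectangular. (iii) $S=\mathrm{Id}-T$ satisfies (R). (iv) $A^{-1}$ is rectangular. Consequently, rectangularity is a self-dual property for maximally monotone operators; correspondingly, (R) is a self-dual property for firmly nonexpansive mappings.
   Context: $X$ is a real Hilbert space; $\mathrm{Id}$ is the identity on $X$. $T\colon X\to X$ is firmly nonexpansive if $\|Tx-Ty\|^2+\|(\mathrm{Id}-T)x-(\mathrm{Id}-T)y\|^2\leq\|x-y\|^2$ for all $x,y\in X$. For $A\colon X\rightrightarrows X$ (so $Ax\subseteq X$ for each $x$): $\operatorname{gr}A=\{(x,u):u\in Ax\}$, $\operatorname{dom}A=\{x:Ax\neq\varnothing\}$, $\operatorname{ran}A=\bigcup_xAx$, and $x\in A^{-1}u\Leftrightarrow u\in Ax$. $A$ is monotone if $\langle x-y,u-v\rangle\geq0$ for all $(x,u),(y,v)\in\operatorname{gr}A$, and maximally monotone if it is monotone with no proper monotone extension. $A$ is rectangular (or $3^*$ monotone) if for all $x\in\operatorname{dom}A$ and $v\in\operatorname{ran}A$, $\inf_{(z,w)\in\operatorname{gr}A}\langle x-z,v-w\rangle>-\infty$.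 The resolvent of a maximally monotone $A$ is $J_A=(\mathrm{Id}+A)^{-1}\colon X\to X$. A property of firmly nonexpansive mappings on $X$ is self-dual if, for every firmly nonexpansive $T\colon X\to X$, $T$ has it if and only if $\mathrm{Id}-T$ has it; a property of maximally monotone operators on $X$ is self-dual if, for every maximally monotone $A$, $A$ has it if and only if $A^{-1}$ has it. *)

theory Defs
  imports "HOL-Analysis.Analysis"
begin

text \<open>A set-valued operator on \<open>X\<close> is a function of type \<open>'a \<Rightarrow> 'a set\<close>; a real Hilbert space is a type
  of sort \<open>{real_inner, complete_space}\<close> (completeness is only required where it is needed).\<close>

definition op_graph :: "('a \<Rightarrow> 'a set) \<Rightarrow> ('a \<times> 'a) set" where
  "op_graph A = {(x, u). u \<in> A x}"

definition op_dom :: "('a \<Rightarrow> 'a set) \<Rightarrow> 'a set" where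
  "op_dom A = {x. A x \<noteq> {}}"

definition op_ran :: "('a \<Rightarrow> 'a set) \<Rightarrow> 'a set" where
  "op_ran A = (\<Union>x. A x)"

definition op_inverse :: "('a \<Rightarrow> 'a set) \<Rightarrow> 'a \<Rightarrow> 'a set" where
  "op_inverse A u = {x. u \<in> A x}"

definition op_of :: "('a \<Rightarrow> 'a) \<Rightarrow> 'a \<Rightarrow> 'a set" where
  "op_of T x = {T x}"

text \<open>Sums and differences of operators are pointwise Minkowski sums and differences; note that
  \<open>-\<close> on type \<open>'a set\<close> itself is set difference.\<close>

definition op_add :: "('a \<Rightarrow> 'a set) \<Rightarrow> ('a \<Rightarrow> 'a set) \<Rightarrow> 'a \<Rightarrow> 'a::ab_group_add set" where
  "op_add A B x = {u + v | u v. u \<in> A x \<and> v \<in> B x}"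

definition op_diff :: "('a \<Rightarrow> 'a set) \<Rightarrow> ('a \<Rightarrow> 'a set) \<Rightarrow> 'a \<Rightarrow> 'a::ab_group_add set" where
  "op_diff A B x = {u - v | u v. u \<in> A x \<and> v \<in> B x}"

text \<open>The resolvent is kept set-valued here; that it is the mapping \<open>T\<close> is expressed by
  \<open>op_of T = resolvent A\<close>.\<close>

definition resolvent :: "('a \<Rightarrow> 'a set) \<Rightarrow> 'a \<Rightarrow> 'a::ab_group_add set" where
  "resolvent A = op_inverse (op_add (op_of id) A)"

definition firmly_nonexpansive :: "('a \<Rightarrow> 'a::real_inner) \<Rightarrow> bool" where
  "firmly_nonexpansive T \<longleftrightarrow>
     (\<forall>x y. (norm (T x - T y))\<^sup>2 + (norm ((x - T x) - (y - T y)))\<^sup>2 \<le> (norm (x - y))\<^sup>2)"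

definition monotone_op :: "('a \<Rightarrow> 'a::real_inner set) \<Rightarrow> bool" where
  "monotone_op A \<longleftrightarrow>
     (\<forall>(x, u) \<in> op_graph A. \<forall>(y, v) \<in> op_graph A. inner (x - y) (u - v) \<ge> 0)"

definition maximally_monotone :: "('a \<Rightarrow> 'a::real_inner set) \<Rightarrow> bool" where
  "maximally_monotone A \<longleftrightarrow>
     monotone_op A \<and> \<not> (\<exists>B. monotone_op B \<and> op_graph A \<subset> op_graph B)"

text \<open>The infima below are taken in the extended reals, where \<open>-\<infinity>\<close> is a genuine value (unlike for
  \<open>Inf\<close> on \<open>real\<close>, which is unspecified on sets not bounded below).\<close>

definition rectangular :: "('a \<Rightarrow> 'a::real_inner set) \<Rightarrow> bool" where
  "rectangular A \<longleftrightarrow>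
     (\<forall>x \<in> op_dom A. \<forall>v \<in> op_ran A.
        (INF (z, w) \<in> op_graph A. ereal (inner (x - z) (v - w))) > -\<infinity>)"

definition property_R :: "('a \<Rightarrow> 'a::real_inner) \<Rightarrow> bool" where
  "property_R S \<longleftrightarrow>
     (\<forall>x y. (INF z. ereal (inner (S x - S z) ((y - S y) - (z - S z)))) > -\<infinity>)"

definition self_dual_firmly_nonexpansive :: "(('a \<Rightarrow> 'a::real_inner) \<Rightarrow> bool) \<Rightarrow> bool" where
  "self_dual_firmly_nonexpansive P \<longleftrightarrow>
     (\<forall>T. firmly_nonexpansive T \<longrightarrow> (P T \<longleftrightarrow> P (\<lambda>x. x - T x)))"

definition self_dual_maximally_monotone :: "(('a \<Rightarrow> 'a::real_inner set) \<Rightarrow> bool) \<Rightarrow> bool" where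
  "self_dual_maximally_monotone P \<longleftrightarrow>
     (\<forall>A. maximally_monotone A \<longrightarrow> (P A \<longleftrightarrow> P (op_inverse A)))"

end

theory Submission
  imports Defs
begin

text \<open>If \<open>T = J\<^sub>A\<close>, then \<open>z \<mapsto> (T z, z - T z)\<close> parametrises the graph of \<open>A\<close> (Minty), so (R) for \<open>T\<close>
  is rectangularity of \<open>A\<close> written in this parametrisation. Both properties are self-dual because
  the inner product is symmetric: passing to the inverse, or to \<open>Id - T\<close>, only exchanges its two
  arguments.\<close>

lemma op_of_eq_resolvent_iff:
  fixes T :: "'a::ab_group_add \<Rightarrow> 'a"
  shows "op_of T = resolvent A \<longleftrightarrow> (\<forall>y u. u \<in> A y \<longleftrightarrow> T (u + y) = y)"
proof -
  have res: "y \<in> resolvent A x \<longleftrightarrow> x - y \<in> A y" for x y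
    by (force simp: resolvent_def op_inverse_def op_add_def op_of_def)
  have "op_of T = resolvent A \<longleftrightarrow> (\<forall>x y. y = T x \<longleftrightarrow> x - y \<in> A y)"
    by (simp add: fun_eq_iff set_eq_iff res) (simp add: op_of_def)
  \<comment> \<open>The substitution \<open>x = u + y\<close> turns \<open>x - y\<close> into
    \<open>u\<close>.\<close>
  also have "\<dots> \<longleftrightarrow> (\<forall>y u. u \<in> A y \<longleftrightarrow> T (u + y) = y)"
    by (metis add_diff_cancel diff_add_cancel)
  finally show ?thesis .
qed

text \<open>The right-hand side is the same pointwise condition as for the resolvent, which links
  the two descriptions of the pair \<open>T\<close>, \<open>A\<close>.\<close>

lemma eq_inverse_diff_id_iff:
  fixes T :: "'a::ab_group_add \<Rightarrow> 'a"
  shows "A = op_diff (op_inverse (op_of T)) (op_of id) \<longleftrightarrow> (\<forall>y u. u \<in> A y \<longleftrightarrow> T (u + y) = y)"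
proof -
  have "u \<in> op_diff (op_inverse (op_of T)) (op_of id) y \<longleftrightarrow> T (u + y) = y" for u y
    by (auto simp: op_diff_def op_inverse_def op_of_def intro!: exI[of _ "u + y"])
  then show ?thesis
    by (simp add: fun_eq_iff set_eq_iff)
qed

text \<open>A graph point \<open>(y, u)\<close> comes from \<open>z = u + y\<close>, since then
  \<open>T z = y\<close> and \<open>z - T z = u\<close>; conversely
  \<open>z = (z - T z) + T z\<close>.\<close>

lemma op_graph_resolvent:
  fixes T :: "'a::ab_group_add \<Rightarrow> 'a"
  assumes "op_of T = resolvent A"
  shows "op_graph A = range (\<lambda>z. (T z, z - T z))"
  using assms unfolding op_of_eq_resolvent_iff op_graph_def
  by (auto simp: image_iff) (metis add_diff_cancel)

lemma op_dom_conv_graph: "op_dom A = fst ` op_graph A"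
  by (force simp: op_dom_def op_graph_def)

lemma op_ran_conv_graph: "op_ran A = snd ` op_graph A"
  by (force simp: op_ran_def op_graph_def)

lemma op_graph_inverse: "op_graph (op_inverse A) = prod.swap ` op_graph A"
  by (force simp: op_graph_def op_inverse_def)

lemma property_R_iff_rectangular:
  assumes "op_of T = resolvent A"
  shows "property_R T \<longleftrightarrow> rectangular A"
  \<comment> \<open>As projections of the graph, domain and range consist of the points
    \<open>T x\<close> and \<open>y - T y\<close> with independent \<open>x\<close>,
    \<open>y\<close>, just as in (R).\<close>
  unfolding property_R_def rectangular_def op_dom_conv_graph op_ran_conv_graph
    op_graph_resolvent[OF assms]
  by (simp add: image_image)

text \<open>Since \<open>x - (x - T x) = T x\<close>, the two factors of the inner product trade
  places, and with them \<open>x\<close> and \<open>y\<close>.\<close>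

lemma property_R_complement: "property_R (\<lambda>x. x - T x) \<longleftrightarrow> property_R T"
  unfolding property_R_def by (auto simp: inner_commute)

text \<open>Inversion exchanges domain and range, so after symmetry of \<open>inner\<close> only the
  order of the two outer quantifiers differs.\<close>

lemma rectangular_inverse: "rectangular (op_inverse A) \<longleftrightarrow> rectangular A"
  unfolding rectangular_def op_dom_conv_graph op_ran_conv_graph op_graph_inverse
  by (simp add: image_image case_prod_unfold inner_commute) blast

theorem theorem3p14:
  shows "(\<forall>(T :: 'a::{real_inner, complete_space} \<Rightarrow> 'a) (A :: 'a \<Rightarrow> 'a set).
            firmly_nonexpansive T \<longrightarrow> maximally_monotone A \<longrightarrow>
              (op_of T = resolvent A \<longleftrightarrow> A = op_diff (op_inverse (op_of T)) (op_of id)) \<and>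
              (op_of T = resolvent A \<longrightarrow>
                 (property_R T \<longleftrightarrow> rectangular A) \<and>
                 (rectangular A \<longleftrightarrow> property_R (\<lambda>x. x - T x)) \<and>
                 (property_R (\<lambda>x. x - T x) \<longleftrightarrow> rectangular (op_inverse A)))) \<and>
         self_dual_maximally_monotone (rectangular :: ('a \<Rightarrow> 'a set) \<Rightarrow> bool) \<and>
         self_dual_firmly_nonexpansive (property_R :: ('a \<Rightarrow> 'a) \<Rightarrow> bool)"
  \<comment> \<open>The rewriting makes both self-duality claims trivial and merges (iii) with (i)
    and (iv) with (ii).\<close>
  unfolding self_dual_maximally_monotone_def self_dual_firmly_nonexpansive_def
    property_R_complement rectangular_inverse eq_inverse_diff_id_iff
  using property_R_iff_rectangular op_of_eq_resolvent_iff by blast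

end
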